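(* Let $H\in[0,+\infty)^{M\times N}$ have rows $H_m=(H_{m,n})_{1\le n\le N}$, let $y=(y_m)_{1\le m\le M}\in\mathbb{N}^M$ and $b_m\in(0,+\infty)$ for $1\le m\le M$. Assume $\sum_{n=1}^N H_{m,n}>0$ for every $m$ and that all components of $H^\top y$ are positive. Let $\zeta_m=1/\sum_{n=1}^N H_{m,n}$, $\rho=\min_{1\le m\le M}\zeta_m b_m$, and $$\ell(x)=-\sum_{m=1}^M y_m\ln(H_m x+b_m),\qquad x\in(-\rho,+\infty)^N .$$ Each of the following functions $h$ (extended by $+\infty$ outside the indicated set $\mathcal{D}$) is a Legendre function, and the function $x\in\mathcal{D}\mapsto \ell(z)+\langle\nabla\ell(z),x-z\rangle+D_h(x,z)$ is a Bregman tangent majorant of $\ell$ at $z$ on $\mathcal{D}$ associated with $h$: (Maj-1) $\mathcal{D}=(-\rho,+\infty)^N$, $z\in\mathcal{D}$, $h_{1,z}(x)=-\sum_{n=1}^N a_{1,n}(z)\ln(x_n+\rho)$ for $x\in\mathcal{D}$, with $a_{1,n}(z)=\sum_{m=1}^M y_m\frac{H_{m,n}(z_n+\zeta_m b_m)}{H_m z+b_m}$. (Maj-2) $\mathcal{D}=(-\rho,+\infty)^N$, $z\in\mathcal{D}$, $h_{2,z}(x)=-\sum_{n=1}^N a_{2,n}\ln(x_n+\rho)$ for $x\in\mathcal{D}$, with $a_{2,n}=\sum_{m=1}^M y_m\mathbf{1}_{H_{m,n}\ne0}$. (Maj-3) $\mathcal{D}=(-\rho,+\infty)^N$, $z\in\mathcal{D}$,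 $h_{3,z}(x)=\sum_{n=1}^N a_{1,n}(z)\varphi_n(x_n)$ for $x\in\mathcal{D}$, where, for $\xi\in(-\rho,+\infty)$, $$\varphi_n(\xi)=\mathbf{1}_{\xi\ge z_n}\Big(\frac{(\xi-z_n)^2}{2(z_n+\rho)^2}-\frac{\xi-z_n}{z_n+\rho}\Big)-\mathbf{1}_{\xi<z_n}\ln\Big(\frac{\xi+\rho}{z_n+\rho}\Big).$$ (Maj-4) $\mathcal{D}=(-\mu,+\infty)^N$ with $\mu\in[0,\rho]$, $z\in\mathcal{D}$, $h_{4,z}(x)=-\sum_{n=1}^N a_{4,n}(z)\ln(x_n+\mu)$ for $x\in\mathcal{D}$, with $a_{4,n}(z)=\sum_{m=1}^M y_m\frac{H_{m,n}(z_n+\mu)}{H_m z+b_m}$. In addition, for every $z\in(-\rho,+\infty)^N$: (i) $h_{1,z}\preceq h_{2,z}$; (ii) $h_{1,z}\preceq h_{3,z}$; (iii) if $\mu=\rho$, $h_{4,z}\preceq h_{1,z}$.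
   Context: $x_n,z_n$ are the components of $x,z\in\mathbb{R}^N$; $\mathbf{1}$ denotes an indicator taking values in $\{0,1\}$; $\langle\cdot,\cdot\rangle$, $\|\cdot\|$ are Euclidean; $\Gamma_0(\mathbb{R}^N)$ is the set of proper lower semicontinuous convex functions $\mathbb{R}^N\to\mathbb{R}\cup\{+\infty\}$. Legendre functions. $h\in\Gamma_0(\mathbb{R}^N)$ is essentially smooth if it is differentiable on $\operatorname{int}(\operatorname{dom} h)$ and $\|\nabla h(y^k)\|\to+\infty$ for every sequence $(y^k)$ in $\operatorname{int}(\operatorname{dom} h)$ converging to a boundary point of $\operatorname{dom} h$; it is Legendre if it is essentially smooth and strictly convex on $\operatorname{int}(\operatorname{dom} h)$. The Bregman distance of a Legendre function $h$ is $D_h(x,y)=h(x)-h(y)-\langle\nabla h(y),x-y\rangle$ for $(x,y)\in\operatorname{dom} h\times\operatorname{int}(\operatorname{dom} h)$. Bregman tangent majorant. For a function $f$ differentiable on an open set $\mathcal{D}\subset\mathbb{R}^N$, $z\in\mathcal{D}$ and a Legendre function $h_z$, the function $Q_f(x,z)=f(z)+\langle\nabla f(z),x-z\rangle+D_{h_z}(x,z)$, $x\in\mathcal{D}$, is a Bregman tangent majorant of $f$ at $z$ associated with $h_z$ if $f(x)\le Q_f(x,z)$ for all $x\in\mathcal{D}$. Order. For Legendre functions $h_1,h_2$, $h_1\preceq h_2$ means $D_{h_1}(x,y)\le D_{h_2}(x,y)$ for all $(x,y)\in(\operatorname{dom} h_1\cap\operatorname{dom} h_2)\times(\operatorname{int}(\operatorname{dom}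 h_1)\cap\operatorname{int}(\operatorname{dom} h_2))$. *)

theory Defs
  imports "HOL-Analysis.Analysis"
begin

section \<open>Extended-valued convex functions\<close>

definition edom :: "('a \<Rightarrow> ereal) \<Rightarrow> 'a set" where
  "edom h = {x. h x < \<infinity>}"

definition eproper :: "('a \<Rightarrow> ereal) \<Rightarrow> bool" where
  "eproper h \<longleftrightarrow> edom h \<noteq> {} \<and> (\<forall>x. h x \<noteq> -\<infinity>)"

definition lower_semicontinuous :: "('a::topological_space \<Rightarrow> ereal) \<Rightarrow> bool" where
  "lower_semicontinuous h \<longleftrightarrow> (\<forall>x. h x \<le> Liminf (at x) h)"

text \<open>An extended-valued function is convex when its epigraph is a convex set; the library's
  \<open>convex_on\<close> and \<open>epigraph\<close> only cover real-valued functions.\<close>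

definition econvex :: "('a::real_vector \<Rightarrow> ereal) \<Rightarrow> bool" where
  "econvex h \<longleftrightarrow> convex {(x, r::real). h x \<le> ereal r}"

definition Gamma0 :: "('a::euclidean_space \<Rightarrow> ereal) set" where
  "Gamma0 = {h. eproper h \<and> lower_semicontinuous h \<and> econvex h}"

section \<open>Legendre functions and Bregman distances\<close>

definition grad :: "('a::real_inner \<Rightarrow> real) \<Rightarrow> 'a \<Rightarrow> 'a" where
  "grad f x = (THE g. GDERIV f x :> g)"

text \<open>Differentiability and gradients of an extended-valued function are only ever used in the
  interior of its domain, where it agrees with its real part near the point.\<close>

abbreviation real_part :: "('a \<Rightarrow> ereal) \<Rightarrow> 'a \<Rightarrow> real" where
  "real_part h \<equiv> (\<lambda>x. real_of_ereal (h x))"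

definition essentially_smooth :: "('a::euclidean_space \<Rightarrow> ereal) \<Rightarrow> bool" where
  "essentially_smooth h \<longleftrightarrow>
     (\<forall>x \<in> interior (edom h). real_part h differentiable (at x)) \<and>
     (\<forall>(u :: nat \<Rightarrow> 'a) l. (\<forall>k. u k \<in> interior (edom h)) \<longrightarrow> l \<in> frontier (edom h) \<longrightarrow>
        u \<longlonglongrightarrow> l \<longrightarrow> filterlim (\<lambda>k. norm (grad (real_part h) (u k))) at_top sequentially)"

definition strictly_convex_on :: "'a::real_vector set \<Rightarrow> ('a \<Rightarrow> real) \<Rightarrow> bool" where
  "strictly_convex_on S f \<longleftrightarrow> convex S \<and>
     (\<forall>x \<in> S. \<forall>y \<in> S. \<forall>t. x \<noteq> y \<longrightarrow> 0 < t \<longrightarrow> t < 1 \<longrightarrow>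
        f ((1 - t) *\<^sub>R x + t *\<^sub>R y) < (1 - t) * f x + t * f y)"

definition legendre :: "('a::euclidean_space \<Rightarrow> ereal) \<Rightarrow> bool" where
  "legendre h \<longleftrightarrow> h \<in> Gamma0 \<and> essentially_smooth h \<and>
     strictly_convex_on (interior (edom h)) (real_part h)"

text \<open>Meaningful for \<open>x \<in> edom h\<close> and \<open>y \<in> interior (edom h)\<close>.\<close>

definition bregman_dist :: "('a::euclidean_space \<Rightarrow> ereal) \<Rightarrow> 'a \<Rightarrow> 'a \<Rightarrow> real" where
  "bregman_dist h x y =
     real_part h x - real_part h y - grad (real_part h) y \<bullet> (x - y)"

definition legendre_le ::
    "('a::euclidean_space \<Rightarrow> ereal) \<Rightarrow> ('a \<Rightarrow> ereal) \<Rightarrow> bool" (infix "\<preceq>\<^sub>L" 50) where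
  "h1 \<preceq>\<^sub>L h2 \<longleftrightarrow>
     (\<forall>x \<in> edom h1 \<inter> edom h2. \<forall>y \<in> interior (edom h1) \<inter> interior (edom h2).
        bregman_dist h1 x y \<le> bregman_dist h2 x y)"

section \<open>Bregman tangent majorants\<close>

definition tangent_approx ::
    "('a::euclidean_space \<Rightarrow> real) \<Rightarrow> ('a \<Rightarrow> ereal) \<Rightarrow> 'a \<Rightarrow> 'a \<Rightarrow> real" where
  "tangent_approx f h x z = f z + grad f z \<bullet> (x - z) + bregman_dist h x z"

text \<open>The inclusions \<open>D \<subseteq> edom h\<close> and \<open>z \<in> interior (edom h)\<close> are what makes
  \<open>bregman_dist h x z\<close> well defined for every \<open>x \<in> D\<close>.\<close>

definition bregman_tangent_majorant ::
    "('a::euclidean_space \<Rightarrow> real) \<Rightarrow> 'a set \<Rightarrow> 'a \<Rightarrow> ('a \<Rightarrow> ereal) \<Rightarrow> bool" where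
  "bregman_tangent_majorant f D z h \<longleftrightarrow>
     open D \<and> f differentiable_on D \<and> z \<in> D \<and>
     legendre h \<and> D \<subseteq> edom h \<and> z \<in> interior (edom h) \<and>
     (\<forall>x \<in> D. f x \<le> tangent_approx f h x z)"

section \<open>The Poisson-type likelihood and its majorants\<close>

definition shifted_orthant :: "real \<Rightarrow> (real ^ 'n) set" where
  "shifted_orthant c = {x. \<forall>n. - c < x $ n}"

definition extend_infty :: "'a set \<Rightarrow> ('a \<Rightarrow> real) \<Rightarrow> 'a \<Rightarrow> ereal" where
  "extend_infty D g x = (if x \<in> D then ereal (g x) else \<infinity>)"

definition zeta :: "real ^ 'n ^ 'm \<Rightarrow> 'm \<Rightarrow> real" where
  "zeta H m = 1 / (\<Sum>n\<in>UNIV. H $ m $ n)"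

definition rho :: "real ^ 'n ^ 'm \<Rightarrow> real ^ 'm \<Rightarrow> real" where
  "rho H b = Min (range (\<lambda>m. zeta H m * b $ m))"

text \<open>Only the values on \<open>shifted_orthant (rho H b)\<close>, where all arguments of the logarithm are
  positive, are relevant.\<close>

definition ell :: "real ^ 'n ^ 'm \<Rightarrow> nat ^ 'm \<Rightarrow> real ^ 'm \<Rightarrow> real ^ 'n \<Rightarrow> real" where
  "ell H y b x = - (\<Sum>m\<in>UNIV. real (y $ m) * ln ((H *v x) $ m + b $ m))"

definition a1 :: "real ^ 'n ^ 'm \<Rightarrow> nat ^ 'm \<Rightarrow> real ^ 'm \<Rightarrow> real ^ 'n \<Rightarrow> 'n \<Rightarrow> real" where
  "a1 H y b z n =
     (\<Sum>m\<in>UNIV. real (y $ m) * (H $ m $ n * (z $ n + zeta H m * b $ m) / ((H *v z) $ m + b $ m)))"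

definition a2 :: "real ^ 'n ^ 'm \<Rightarrow> nat ^ 'm \<Rightarrow> 'n \<Rightarrow> real" where
  "a2 H y n = (\<Sum>m\<in>UNIV. real (y $ m) * of_bool (H $ m $ n \<noteq> 0))"

definition a4 ::
    "real ^ 'n ^ 'm \<Rightarrow> nat ^ 'm \<Rightarrow> real ^ 'm \<Rightarrow> real \<Rightarrow> real ^ 'n \<Rightarrow> 'n \<Rightarrow> real" where
  "a4 H y b \<mu> z n =
     (\<Sum>m\<in>UNIV. real (y $ m) * (H $ m $ n * (z $ n + \<mu>) / ((H *v z) $ m + b $ m)))"

definition phi :: "real \<Rightarrow> real \<Rightarrow> real \<Rightarrow> real" where
  "phi r v \<xi> =
     of_bool (\<xi> \<ge> v) * ((\<xi> - v)\<^sup>2 / (2 * (v + r)\<^sup>2) - (\<xi> - v) / (v + r))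
     - of_bool (\<xi> < v) * ln ((\<xi> + r) / (v + r))"

definition h1 :: "real ^ 'n ^ 'm \<Rightarrow> nat ^ 'm \<Rightarrow> real ^ 'm \<Rightarrow> real ^ 'n \<Rightarrow> real ^ 'n \<Rightarrow> ereal" where
  "h1 H y b z = extend_infty (shifted_orthant (rho H b))
     (\<lambda>x. - (\<Sum>n\<in>UNIV. a1 H y b z n * ln (x $ n + rho H b)))"

text \<open>Unlike the other three, this function does not depend on the tangency point.\<close>

definition h2 :: "real ^ 'n ^ 'm \<Rightarrow> nat ^ 'm \<Rightarrow> real ^ 'm \<Rightarrow> real ^ 'n \<Rightarrow> ereal" where
  "h2 H y b = extend_infty (shifted_orthant (rho H b))
     (\<lambda>x. - (\<Sum>n\<in>UNIV. a2 H y n * ln (x $ n + rho H b)))"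

definition h3 :: "real ^ 'n ^ 'm \<Rightarrow> nat ^ 'm \<Rightarrow> real ^ 'm \<Rightarrow> real ^ 'n \<Rightarrow> real ^ 'n \<Rightarrow> ereal" where
  "h3 H y b z = extend_infty (shifted_orthant (rho H b))
     (\<lambda>x. \<Sum>n\<in>UNIV. a1 H y b z n * phi (rho H b) (z $ n) (x $ n))"

definition h4 ::
    "real ^ 'n ^ 'm \<Rightarrow> nat ^ 'm \<Rightarrow> real ^ 'm \<Rightarrow> real \<Rightarrow> real ^ 'n \<Rightarrow> real ^ 'n \<Rightarrow> ereal" where
  "h4 H y b \<mu> z = extend_infty (shifted_orthant \<mu>)
     (\<lambda>x. - (\<Sum>n\<in>UNIV. a4 H y b \<mu> z n * ln (x $ n + \<mu>)))"

end

theory Submission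
  imports Defs
begin

text \<open>All four functions are separable sums of one-dimensional \<open>C\<^sup>1\<close> barriers with strictly increasing
  derivative, so Legendre-ness and the Bregman distances reduce to one dimension. Only (Maj-4) needs
  a convexity argument on the likelihood, namely Jensen's inequality for \<open>-ln\<close> in each row of \<open>H\<close>.
  Since a tangent majorant stays one when its Legendre function is increased for \<open>\<preceq>\<^sub>L\<close>, the other
  three follow from (Maj-4) at \<open>\<mu> = \<rho>\<close> along \<open>h\<^sub>4 \<preceq>\<^sub>L h\<^sub>1 \<preceq>\<^sub>L h\<^sub>2, h\<^sub>3\<close>; the comparisons hold coefficientwise
  (\<open>a\<^sub>4 \<le> a\<^sub>1 \<le> a\<^sub>2\<close>), respectively because \<open>phi\<close> minus the logarithmic barrier is convex.\<close>

section \<open>Gradients\<close>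

text \<open>\<open>grad\<close> is a definite description, so uniqueness has to be shown: two
  gradients induce the same linear functional, and evaluating it at their difference gives
  \<open>0\<close>.\<close>

lemma grad_eqI:
  assumes "GDERIV f x :> g"
  shows "grad f x = g"
proof -
  have "g' = g" if "GDERIV f x :> g'" for g'
  proof -
    have "(\<lambda>h. h \<bullet> g') = (\<lambda>h. h \<bullet> g)"
      using that assms has_derivative_unique unfolding gderiv_def by blast
    then have "(g' - g) \<bullet> g' = (g' - g) \<bullet> g" by metis
    then have "(g' - g) \<bullet> (g' - g) = 0" by (simp add: inner_diff_right)
    then show ?thesis by simp
  qed
  with assms show ?thesis unfolding grad_def by (intro the_equality)
qed

text \<open>Riesz representation in the standard basis. It lets every gradient below enter only
  through inner products, computed from a derivative given as a linear map.\<close>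

lemma inner_grad:
  fixes f :: "'a::euclidean_space \<Rightarrow> real"
  assumes "(f has_derivative F) (at x)"
  shows "grad f x \<bullet> v = F v"
proof -
  interpret F: bounded_linear F using assms by (rule has_derivative_bounded_linear)
  define g where "g = (\<Sum>b\<in>Basis. F b *\<^sub>R b)"
  have *: "F v = v \<bullet> g" for v
  proof -
    have "F v = F (\<Sum>b\<in>Basis. (v \<bullet> b) *\<^sub>R b)" by (simp add: euclidean_representation)
    also have "\<dots> = (\<Sum>b\<in>Basis. (v \<bullet> b) * F b)" by (simp add: F.sum F.scaleR)
    finally show ?thesis by (simp add: g_def inner_sum_right mult.commute)
  qed
  then have "F = (\<lambda>v. v \<bullet> g)" by auto
  with assms have "grad f x = g" by (intro grad_eqI) (simp add: gderiv_def)
  with * show ?thesis by (simp add: inner_commute)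
qed

section \<open>Convexity from tangents\<close>

text \<open>By the mean value theorem the chord slope is \<open>f'\<close> at a point strictly
  between \<open>x\<close> and \<open>y\<close>, which strict monotonicity compares with
  \<open>f' y\<close>.\<close>

lemma above_tangent_strict:
  fixes f :: "real \<Rightarrow> real"
  assumes d: "\<And>t. c < t \<Longrightarrow> (f has_real_derivative f' t) (at t)"
    and m: "strict_mono_on {c<..} f'" and "c < x" "c < y" "x \<noteq> y"
  shows "f y + f' y * (x - y) < f x"
proof (cases "x < y")
  case True
  then obtain t where "x < t" "t < y" "f y - f x = (y - x) * f' t"
    using MVT2[of x y f f'] d assms(3) by fastforce
  moreover have "f' t < f' y" using calculation assms by (intro strict_mono_onD[OF m]) auto
  then have "(y - x) * f' t < (y - x) * f' y" using True by simp
  ultimately show ?thesis by (simp add: algebra_simps)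
next
  case False
  then have "y < x" using assms by simp
  then obtain t where "y < t" "t < x" "f x - f y = (x - y) * f' t"
    using MVT2[of y x f f'] d assms(4) by fastforce
  moreover have "f' y < f' t" using calculation assms by (intro strict_mono_onD[OF m]) auto
  then have "(x - y) * f' y < (x - y) * f' t" using \<open>y < x\<close> by simp
  ultimately show ?thesis by (simp add: algebra_simps)
qed

text \<open>The weak form serves convex functions with flat pieces, such as the difference
  \<open>g\<close> in \<open>bregman_ln_le_phi\<close>.\<close>

lemma above_tangent:
  fixes f :: "real \<Rightarrow> real"
  assumes d: "\<And>t. c < t \<Longrightarrow> (f has_real_derivative f' t) (at t)"
    and m: "mono_on {c<..} f'" and "c < x" "c < y"
  shows "f y + f' y * (x - y) \<le> f x"
proof -
  consider "x < y" | "x = y" | "y < x" by linarith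
  then show ?thesis
  proof cases
    case 1
    then obtain t where "x < t" "t < y" "f y - f x = (y - x) * f' t"
      using MVT2[of x y f f'] d assms(3) by fastforce
    moreover have "f' t \<le> f' y" using calculation assms by (intro mono_onD[OF m]) auto
    then have "(y - x) * f' t \<le> (y - x) * f' y" using 1 by simp
    ultimately show ?thesis by (simp add: algebra_simps)
  next
    case 3
    then obtain t where "y < t" "t < x" "f x - f y = (x - y) * f' t"
      using MVT2[of y x f f'] d assms(4) by fastforce
    moreover have "f' y \<le> f' t" using calculation assms by (intro mono_onD[OF m]) auto
    then have "(x - y) * f' y \<le> (x - y) * f' t" using 3 by simp
    ultimately show ?thesis by (simp add: algebra_simps)
  qed simp
qed

text \<open>Take the tangent at the convex combination \<open>p\<close> itself. Weighting its two
  inequalities by \<open>1 - t\<close> and \<open>t\<close> cancels the linear terms, since the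
  weighted displacements from \<open>p\<close> sum to zero.\<close>

lemma strictly_convex_onI_tangent:
  assumes S: "convex S"
    and lin: "\<And>p. p \<in> S \<Longrightarrow> linear (L p)"
    and tan: "\<And>p x. p \<in> S \<Longrightarrow> x \<in> S \<Longrightarrow> x \<noteq> p \<Longrightarrow> f p + L p (x - p) < (f x :: real)"
  shows "strictly_convex_on S f"
  unfolding strictly_convex_on_def
proof (intro conjI ballI allI impI)
  fix x y and t :: real
  assume x: "x \<in> S" and y: "y \<in> S" and "x \<noteq> y" and t: "0 < t" "t < 1"
  define p where "p = (1 - t) *\<^sub>R x + t *\<^sub>R y"
  have pS: "p \<in> S" unfolding p_def using S x y t by (simp add: convexD)
  interpret L: linear "L p" using lin[OF pS] .
  have xp: "x - p = t *\<^sub>R (x - y)" and yp: "y - p = (t - 1) *\<^sub>R (x - y)"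
    by (simp_all add: p_def algebra_simps)
  have "x \<noteq> p" "y \<noteq> p" using xp yp t \<open>x \<noteq> y\<close> by auto
  then have "f p + L p (x - p) < f x" "f p + L p (y - p) < f y" using tan pS x y by auto
  then have "(1 - t) * (f p + L p (x - p)) + t * (f p + L p (y - p)) < (1 - t) * f x + t * f y"
    using t by (intro add_strict_mono mult_strict_left_mono) auto
  then show "f p < (1 - t) * f x + t * f y"
    unfolding xp yp L.scaleR by (simp add: algebra_simps)
qed (use S in auto)

lemma strictly_convex_on_imp_econvex:
  assumes "strictly_convex_on D g"
  shows "econvex (extend_infty D g)"
  unfolding econvex_def
proof (rule convexI)
  fix p q :: "'a \<times> real" and u v :: real
  assume pq: "p \<in> {(x, r). extend_infty D g x \<le> ereal r}" "q \<in> {(x, r). extend_infty D g x \<le> ereal r}"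
    and uv: "0 \<le> u" "0 \<le> v" "u + v = 1"
  obtain x r where p: "p = (x, r)" by fastforce
  obtain y s where q: "q = (y, s)" by fastforce
  have xy: "x \<in> D" "y \<in> D" "g x \<le> r" "g y \<le> s"
    using pq by (auto simp: p q extend_infty_def split: if_splits)
  have u: "u = 1 - v" using uv by simp
  have mem: "u *\<^sub>R x + v *\<^sub>R y \<in> D"
    using assms xy uv unfolding strictly_convex_on_def by (simp add: convexD)
  have "g (u *\<^sub>R x + v *\<^sub>R y) \<le> u * g x + v * g y"
  \<comment> \<open>Strict convexity speaks only of distinct points and weights inside the unit
    interval; in the degenerate cases equality holds.\<close>
  proof (cases "x = y \<or> v = 0 \<or> v = 1")
    case True
    then show ?thesis by (auto simp: u algebra_simps)
  next
    case False
    then show ?thesis using assms xy uv unfolding strictly_convex_on_def u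
      by (intro less_imp_le) auto
  qed
  also have "\<dots> \<le> u * r + v * s" using xy uv by (intro add_mono mult_left_mono) auto
  finally show "u *\<^sub>R p + v *\<^sub>R q \<in> {(x, r). extend_infty D g x \<le> ereal r}"
    using mem by (simp add: p q extend_infty_def)
qed

section \<open>Separable barriers on a shifted orthant\<close>

lemma edom_extend_infty [simp]: "edom (extend_infty D g) = D"
  by (auto simp: edom_def extend_infty_def)

lemma real_part_extend_infty: "x \<in> D \<Longrightarrow> real_part (extend_infty D g) x = g x"
  by (simp add: extend_infty_def)

lemma shifted_orthant_eq: "shifted_orthant c = (\<Inter>n. {x. - c < x $ n})"
  by (auto simp: shifted_orthant_def)

lemma shifted_orthantD: "0 < x $ n + c" if "x \<in> shifted_orthant c"
proof -
  have "- c < x $ n" using that by (simp add: shifted_orthant_def)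
  then show ?thesis by simp
qed

lemma open_shifted_orthant: "open (shifted_orthant c)"
  unfolding shifted_orthant_eq by (intro open_INT ballI open_Collect_less continuous_intros) auto

lemma convex_shifted_orthant: "convex (shifted_orthant c :: (real ^ 'n) set)"
  unfolding shifted_orthant_eq
proof (rule convex_INT)
  fix n :: 'n
  have "{x :: real ^ 'n. - c < x $ n} = {x. axis n 1 \<bullet> x > - c}" by (simp add: inner_axis')
  then show "convex {x :: real ^ 'n. - c < x $ n}" by (simp only: convex_halfspace_gt)
qed

text \<open>One-dimensional model of a Legendre function on the ray above \<open>-c\<close>. Strict
  monotonicity of \<open>f'\<close> yields strict convexity, the blow-up of \<open>f\<close> yields
  lower semicontinuity at the boundary, and that of \<open>f'\<close> yields essential
  smoothness.\<close>

definition barrier :: "real \<Rightarrow> (real \<Rightarrow> real) \<Rightarrow> (real \<Rightarrow> real) \<Rightarrow> bool" where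
  "barrier c f f' \<longleftrightarrow>
     (\<forall>t>-c. (f has_real_derivative f' t) (at t)) \<and> strict_mono_on {-c<..} f' \<and>
     filterlim f at_top (at_right (-c)) \<and> filterlim f' at_bot (at_right (-c))"

definition separable :: "real \<Rightarrow> ('n \<Rightarrow> real \<Rightarrow> real) \<Rightarrow> real ^ 'n \<Rightarrow> ereal" where
  "separable c f = extend_infty (shifted_orthant c) (\<lambda>x. \<Sum>n\<in>UNIV. f n (x $ n))"

lemma edom_separable [simp]: "edom (separable c f) = shifted_orthant c"
  by (simp add: separable_def)

lemma interior_shifted_orthant [simp]: "interior (shifted_orthant c) = shifted_orthant c"
  by (simp add: interior_open open_shifted_orthant)

lemma real_part_separable:
  "x \<in> shifted_orthant c \<Longrightarrow> real_part (separable c f) x = (\<Sum>n\<in>UNIV. f n (x $ n))"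
  by (simp add: separable_def real_part_extend_infty)

text \<open>A zero factor would destroy strict monotonicity and both limits; hence the strict
  positivity results for the coefficients below.\<close>

lemma barrier_scale:
  assumes "barrier c f f'" "0 < a"
  shows "barrier c (\<lambda>t. a * f t) (\<lambda>t. a * f' t)"
  unfolding barrier_def
proof (intro conjI allI impI)
  show "((\<lambda>t. a * f t) has_real_derivative a * f' t) (at t)" if "-c < t" for t
    using assms that by (intro DERIV_cmult) (simp add: barrier_def)
  show "strict_mono_on {-c<..} (\<lambda>t. a * f' t)"
    using assms by (auto simp: barrier_def strict_mono_on_def)
  show "filterlim (\<lambda>t. a * f t) at_top (at_right (-c))"
    by (rule filterlim_tendsto_pos_mult_at_top[OF tendsto_const])
      (use assms in \<open>auto simp: barrier_def\<close>)
  show "filterlim (\<lambda>t. a * f' t) at_bot (at_right (-c))"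
    by (rule filterlim_tendsto_pos_mult_at_bot[OF tendsto_const])
      (use assms in \<open>auto simp: barrier_def\<close>)
qed

lemma sum_nth_has_derivative:
  fixes x :: "real ^ 'n"
  assumes "\<And>n. (f n has_real_derivative d n) (at (x $ n))"
  shows "((\<lambda>x. \<Sum>n\<in>UNIV. f n (x $ n)) has_derivative (\<lambda>v. \<Sum>n\<in>UNIV. d n * v $ n)) (at x)"
proof (rule has_derivative_sum)
  fix n
  have "((\<lambda>x::real^'n. x $ n) has_derivative (\<lambda>v. v $ n)) (at x)"
    by (rule bounded_linear_imp_has_derivative) (rule bounded_linear_vec_nth)
  from has_derivative_compose[OF this assms[of n, unfolded has_field_derivative_def]]
  show "((\<lambda>x. f n (x $ n)) has_derivative (\<lambda>v. d n * v $ n)) (at x)" .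
qed

section \<open>Legendre property and Bregman distance of a separable sum of barriers\<close>

context
  fixes c :: real and f f' :: "'n::finite \<Rightarrow> real \<Rightarrow> real"
  assumes barrier: "\<And>n. barrier c (f n) (f' n)"
begin

lemma barrier_deriv: "-c < t \<Longrightarrow> (f n has_real_derivative f' n t) (at t)"
  using barrier by (auto simp: barrier_def)

lemma separable_has_derivative:
  assumes "x \<in> shifted_orthant c"
  shows "(real_part (separable c f) has_derivative (\<lambda>v. \<Sum>n\<in>UNIV. f' n (x $ n) * v $ n)) (at x)"
proof (rule has_derivative_transform_within_open[OF _ open_shifted_orthant assms])
  show "((\<lambda>x. \<Sum>n\<in>UNIV. f n (x $ n)) has_derivative (\<lambda>v. \<Sum>n\<in>UNIV. f' n (x $ n) * v $ n)) (at x)"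
    using assms by (intro sum_nth_has_derivative barrier_deriv) (auto simp: shifted_orthant_def)
qed (simp add: real_part_separable)

lemma grad_separable_nth:
  assumes "x \<in> shifted_orthant c"
  shows "grad (real_part (separable c f)) x $ n = f' n (x $ n)"
proof -
  have "grad (real_part (separable c f)) x $ n = grad (real_part (separable c f)) x \<bullet> axis n 1"
    by (simp add: inner_axis)
  also have "\<dots> = (\<Sum>k\<in>UNIV. f' k (x $ k) * axis n 1 $ k)"
    by (rule inner_grad[OF separable_has_derivative[OF assms]])
  also have "\<dots> = (\<Sum>k\<in>UNIV. if k = n then f' n (x $ n) else 0)"
    by (intro sum.cong) (auto simp: axis_def)
  finally show ?thesis by simp
qed

lemma bregman_dist_separable:
  assumes "x \<in> shifted_orthant c" "y \<in> shifted_orthant c"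
  shows "bregman_dist (separable c f) x y =
    (\<Sum>n\<in>UNIV. f n (x $ n) - f n (y $ n) - f' n (y $ n) * (x $ n - y $ n))"
  unfolding bregman_dist_def inner_grad[OF separable_has_derivative[OF assms(2)]]
  using assms by (simp add: real_part_separable sum_subtractf)

text \<open>The tangent inequalities add up over the coordinates, and at least one is strict because
  distinct points differ in some coordinate.\<close>

lemma strictly_convex_sum_barrier:
  "strictly_convex_on (shifted_orthant c) (\<lambda>x. \<Sum>n\<in>UNIV. f n (x $ n))"
proof (rule strictly_convex_onI_tangent[where L = "\<lambda>p v. \<Sum>n\<in>UNIV. f' n (p $ n) * v $ n"])
  fix p x :: "real ^ 'n"
  assume px: "p \<in> shifted_orthant c" "x \<in> shifted_orthant c" "x \<noteq> p"
  then obtain n where n: "x $ n \<noteq> p $ n" by (auto simp: vec_eq_iff)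
  have strict: "f k (p $ k) + f' k (p $ k) * (x $ k - p $ k) < f k (x $ k)" if "x $ k \<noteq> p $ k" for k
    using barrier[of k] px that
    by (intro above_tangent_strict[where c = "-c"]) (auto simp: barrier_def shifted_orthant_def)
  have "(\<Sum>k\<in>UNIV. f k (p $ k) + f' k (p $ k) * (x $ k - p $ k)) < (\<Sum>k\<in>UNIV. f k (x $ k))"
  proof (rule sum_strict_mono_ex1)
    show "\<forall>k\<in>UNIV. f k (p $ k) + f' k (p $ k) * (x $ k - p $ k) \<le> f k (x $ k)"
    proof
      fix k
      show "f k (p $ k) + f' k (p $ k) * (x $ k - p $ k) \<le> f k (x $ k)"
        by (cases "x $ k = p $ k") (use strict[of k] in auto)
    qed
  qed (use strict n in auto)
  then show "(\<Sum>k\<in>UNIV. f k (p $ k)) + (\<Sum>k\<in>UNIV. f' k (p $ k) * (x - p) $ k) < (\<Sum>k\<in>UNIV. f k (x $ k))"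
    by (simp add: sum.distrib)
qed (auto intro!: linearI convex_shifted_orthant simp: algebra_simps sum.distrib sum_distrib_left)

text \<open>The guard \<open>-c < s\<close> replaces a one-sided filter, so that
  \<open>t = -c\<close> and \<open>t < -c\<close> (where the claim is vacuous nearby) are treated
  alike and the result composes with coordinate projections.\<close>

lemma barrier_at_boundary:
  assumes "t \<le> -c"
  shows "\<forall>\<^sub>F s in nhds t. -c < s \<longrightarrow> C < f n s"
proof (cases "t < -c")
  case True
  then show ?thesis using eventually_nhds_in_open[of "{..<-c}" t] by (auto elim: eventually_mono)
next
  case False
  then have t: "t = -c" using assms by simp
  have "\<forall>\<^sub>F s in at_right (-c). C < f n s"
    using barrier[of n] by (auto simp: barrier_def filterlim_at_top_dense)
  then show ?thesis unfolding t eventually_at_filter by (auto elim: eventually_mono)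
qed

text \<open>Ensures that the remaining coordinates cannot offset the blow-up of a single
  one.\<close>

lemma barrier_locally_bounded_below: "\<exists>B. \<forall>\<^sub>F s in nhds t. -c < s \<longrightarrow> B < f n s"
proof (cases "t \<le> -c")
  case True
  then show ?thesis using barrier_at_boundary by blast
next
  case False
  then have "isCont (f n) t" using barrier_deriv[of t n] DERIV_isCont by auto
  then have "(f n \<longlongrightarrow> f n t) (nhds t)" by (simp add: continuous_within tendsto_at_iff_tendsto_nhds)
  then have "\<forall>\<^sub>F s in nhds t. f n t - 1 < f n s" by (rule order_tendstoD) simp
  then show ?thesis by (auto elim: eventually_mono)
qed

text \<open>On the open orthant the function is continuous. Off it, some coordinate \<open>m\<close>
  is at most \<open>-c\<close>; its term exceeds every bound nearby while the others stay bounded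
  below, so the lower limit is infinite.\<close>

lemma lower_semicontinuous_separable: "lower_semicontinuous (separable c f)"
  unfolding lower_semicontinuous_def
proof
  fix x :: "real ^ 'n"
  have nth: "filterlim (\<lambda>u::real^'n. u $ n) (nhds (x $ n)) (at x)" for n
    by (intro tendsto_intros)
  show "separable c f x \<le> Liminf (at x) (separable c f)"
  proof (cases "x \<in> shifted_orthant c")
    case True
    have "isCont (\<lambda>x. \<Sum>n\<in>UNIV. f n (x $ n)) x"
      using True
      by (intro has_derivative_continuous[OF sum_nth_has_derivative[OF barrier_deriv]])
        (auto simp: shifted_orthant_def)
    then have lim: "((\<lambda>x. ereal (\<Sum>n\<in>UNIV. f n (x $ n))) \<longlongrightarrow> ereal (\<Sum>n\<in>UNIV. f n (x $ n))) (at x)"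
      by (intro tendsto_ereal) (simp add: continuous_within)
    have "\<forall>\<^sub>F u in at x. u \<in> shifted_orthant c"
      using True open_shifted_orthant by (rule eventually_at_in_open'[rotated])
    then have "\<forall>\<^sub>F u in at x. ereal (\<Sum>n\<in>UNIV. f n (u $ n)) = separable c f u"
      by eventually_elim (simp add: separable_def extend_infty_def)
    then have "(separable c f \<longlongrightarrow> separable c f x) (at x)"
      using Lim_transform_eventually[OF lim] True by (simp add: separable_def extend_infty_def)
    then show ?thesis by (simp add: lim_imp_Liminf)
  next
    case False
    then obtain m where m: "x $ m \<le> - c" by (auto simp: shifted_orthant_def not_less)
    have "\<forall>n. \<exists>B. \<forall>\<^sub>F s in nhds (x $ n). -c < s \<longrightarrow> B < f n s"
      by (intro allI barrier_locally_bounded_below)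
    from choice[OF this] obtain B where B: "\<forall>n. \<forall>\<^sub>F s in nhds (x $ n). -c < s \<longrightarrow> B n < f n s" ..
    have "ereal C \<le> Liminf (at x) (separable c f)" for C
    proof (rule Liminf_bounded)
      \<comment> \<open>Chosen so that \<open>A\<close> plus the lower bounds of the other
        coordinates is exactly \<open>C\<close>.\<close>
      define A where "A = C - (\<Sum>n\<in>UNIV - {m}. B n)"
      have "\<forall>\<^sub>F u in at x. \<forall>n. -c < u $ n \<longrightarrow> B n < f n (u $ n)"
        by (intro eventually_all_finite eventually_compose_filterlim[OF B[THEN spec] nth])
      moreover have "\<forall>\<^sub>F u in at x. -c < u $ m \<longrightarrow> A < f m (u $ m)"
        by (rule eventually_compose_filterlim[OF barrier_at_boundary[OF m] nth])
      ultimately show "\<forall>\<^sub>F u in at x. ereal C \<le> separable c f u"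
      proof eventually_elim
        case (elim u)
        show ?case
        proof (cases "u \<in> shifted_orthant c")
          case True
          then have "A < f m (u $ m)" "\<And>n. B n \<le> f n (u $ n)"
            using elim by (auto simp: shifted_orthant_def less_imp_le)
          then have "A + (\<Sum>n\<in>UNIV - {m}. B n) \<le> f m (u $ m) + (\<Sum>n\<in>UNIV - {m}. f n (u $ n))"
            by (intro add_mono sum_mono) auto
          also have "\<dots> = (\<Sum>n\<in>UNIV. f n (u $ n))" by (simp add: sum.remove[of UNIV m])
          finally show ?thesis using True by (simp add: A_def separable_def extend_infty_def)
        qed (simp add: separable_def extend_infty_def)
      qed
    qed
    then have "Liminf (at x) (separable c f) = \<infinity>" by (simp add: ereal_top)
    then show ?thesis by simp
  qed
qed

text \<open>A single gradient component that tends to minus infinity already forces the norm to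
  diverge.\<close>

lemma essentially_smooth_separable: "essentially_smooth (separable c f)"
  unfolding essentially_smooth_def edom_separable interior_shifted_orthant
proof (intro conjI ballI allI impI)
  fix x :: "real ^ 'n"
  assume "x \<in> shifted_orthant c"
  then show "real_part (separable c f) differentiable (at x)"
    using separable_has_derivative unfolding differentiable_def by blast
next
  fix u :: "nat \<Rightarrow> real ^ 'n" and l
  assume u: "\<forall>k. u k \<in> shifted_orthant c" and l: "l \<in> frontier (shifted_orthant c)"
    and lim: "u \<longlonglongrightarrow> l"
  have "l \<notin> shifted_orthant c"
    using l by (simp add: frontier_def interior_open open_shifted_orthant)
  then obtain m where m: "l $ m \<le> - c" by (auto simp: shifted_orthant_def not_less)
  have nth: "(\<lambda>k. u k $ m) \<longlonglongrightarrow> l $ m" using lim by (intro tendsto_intros)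
  have gt: "- c < u k $ m" for k using u by (auto simp: shifted_orthant_def)
  \<comment> \<open>Together with \<open>m\<close> this pins the limit to \<open>-c\<close> exactly,
    where \<open>f' m\<close> diverges.\<close>
  have "- c \<le> l $ m" by (rule LIMSEQ_le_const[OF nth]) (use gt less_imp_le in blast)
  with m nth have "(\<lambda>k. u k $ m) \<longlonglongrightarrow> - c" by simp
  with gt have "filterlim (\<lambda>k. u k $ m) (at_right (-c)) sequentially"
    by (simp add: filterlim_at less_imp_neq[symmetric])
  then have "filterlim (\<lambda>k. f' m (u k $ m)) at_bot sequentially"
    using barrier[of m] filterlim_compose unfolding barrier_def by blast
  then have "filterlim (\<lambda>k. - f' m (u k $ m)) at_top sequentially"
    by (simp add: filterlim_uminus_at_bot)
  then show "filterlim (\<lambda>k. norm (grad (real_part (separable c f)) (u k))) at_top sequentially"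
  proof (rule filterlim_at_top_mono)
    have "- f' m (u k $ m) \<le> norm (grad (real_part (separable c f)) (u k))" for k
      using component_le_norm_cart[of "grad (real_part (separable c f)) (u k)" m]
        grad_separable_nth[of "u k" m] u by auto
    then show "\<forall>\<^sub>F k in sequentially. - f' m (u k $ m) \<le> norm (grad (real_part (separable c f)) (u k))"
      by simp
  qed
qed

lemma legendre_separable: "legendre (separable c f)"
proof -
  have "(\<chi> n. 1 - c) \<in> shifted_orthant c" by (simp add: shifted_orthant_def)
  then have "eproper (separable c f)"
    by (auto simp: eproper_def) (simp add: separable_def extend_infty_def split: if_splits)
  moreover have "econvex (separable c f)"
    unfolding separable_def
    by (intro strictly_convex_on_imp_econvex strictly_convex_sum_barrier)
  moreover have "strictly_convex_on (shifted_orthant c) (real_part (separable c f))"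
    using strictly_convex_sum_barrier convex_shifted_orthant[of c]
    by (simp add: strictly_convex_on_def real_part_separable convexD)
  ultimately show ?thesis
    by (simp add: legendre_def Gamma0_def lower_semicontinuous_separable essentially_smooth_separable)
qed

end

section \<open>The order on separable functions and its effect on tangent majorants\<close>

lemma legendre_le_separable:
  fixes f f' g g' :: "'n::finite \<Rightarrow> real \<Rightarrow> real"
  assumes "\<And>n. barrier c (f n) (f' n)" "\<And>n. barrier c (g n) (g' n)"
    and "\<And>n s t. -c < s \<Longrightarrow> -c < t \<Longrightarrow>
      f n s - f n t - f' n t * (s - t) \<le> g n s - g n t - g' n t * (s - t)"
  shows "separable c f \<preceq>\<^sub>L separable c g"
  unfolding legendre_le_def
proof (intro ballI)
  fix x y :: "real ^ 'n"
  assume "x \<in> edom (separable c f) \<inter> edom (separable c g)"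
    "y \<in> interior (edom (separable c f)) \<inter> interior (edom (separable c g))"
  then have x: "x \<in> shifted_orthant c" and y: "y \<in> shifted_orthant c" by simp_all
  then show "bregman_dist (separable c f) x y \<le> bregman_dist (separable c g) x y"
    unfolding bregman_dist_separable[OF assms(1) x y] bregman_dist_separable[OF assms(2) x y]
    by (intro sum_mono assms(3)) (auto simp: shifted_orthant_def)
qed

text \<open>The approximation depends on \<open>h\<close> only through its Bregman distance;
  equality of the domains carries over the domain conditions.\<close>

lemma bregman_tangent_majorant_mono:
  assumes "bregman_tangent_majorant f D z h" "h \<preceq>\<^sub>L h'" "legendre h'" "edom h' = edom h"
  shows "bregman_tangent_majorant f D z h'"
proof -
  have "bregman_dist h x z \<le> bregman_dist h' x z" if "x \<in> D" for x
    using assms that unfolding bregman_tangent_majorant_def legendre_le_def by auto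
  then show ?thesis
    using assms unfolding bregman_tangent_majorant_def tangent_approx_def by fastforce
qed

section \<open>The logarithmic barrier and its quadratic continuation\<close>

lemma barrier_ln: "barrier c (\<lambda>t. - ln (t + c)) (\<lambda>t. - (1 / (t + c)))"
proof -
  have lim: "filterlim (\<lambda>t. t + c) (at_right 0) (at_right (-c))"
    by (auto simp: filterlim_at eventually_at_filter intro!: tendsto_eq_intros)
  have "filterlim (\<lambda>t. - ln (t + c)) at_top (at_right (-c))"
    using filterlim_compose[OF ln_at_0 lim] by (simp add: filterlim_uminus_at_top)
  moreover have "filterlim (\<lambda>t. - (1 / (t + c))) at_bot (at_right (-c))"
    using filterlim_compose[OF filterlim_inverse_at_top_right lim]
    by (simp add: filterlim_uminus_at_bot divide_inverse)
  moreover have "strict_mono_on {-c<..} (\<lambda>t. - (1 / (t + c)))"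
    by (rule strict_mono_onI) (simp add: frac_less2)
  moreover have "((\<lambda>t. - ln (t + c)) has_real_derivative - (1 / (t + c))) (at t)" if "-c < t" for t
    using that by (auto intro!: derivative_eq_intros)
  ultimately show ?thesis by (simp add: barrier_def)
qed

text \<open>The one-dimensional Bregman distance of the logarithmic barrier is nonnegative, so
  enlarging its coefficient enlarges it.\<close>

lemma legendre_le_ln_scale:
  assumes "\<And>n. 0 < a n" "\<And>n. a n \<le> a' n"
  shows "separable c (\<lambda>n t. a n * - ln (t + c)) \<preceq>\<^sub>L separable c (\<lambda>n t. a' n * - ln (t + c))"
proof (rule legendre_le_separable)
  show "barrier c (\<lambda>t. a n * - ln (t + c)) (\<lambda>t. a n * - (1 / (t + c)))" for n
    using barrier_ln assms(1) by (rule barrier_scale)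
  show "barrier c (\<lambda>t. a' n * - ln (t + c)) (\<lambda>t. a' n * - (1 / (t + c)))" for n
    using barrier_ln less_le_trans[OF assms] by (rule barrier_scale)
  fix n and s t :: real
  assume "- c < s" "- c < t"
  then have "0 \<le> - ln (s + c) - - ln (t + c) - - (1 / (t + c)) * (s - t)"
    using above_tangent[where c = "-c" and f = "\<lambda>t. - ln (t + c)" and f' = "\<lambda>t. - (1 / (t + c))" and x = s and y = t]
      barrier_ln[of c] strict_mono_on_imp_mono_on[of "{-c<..}" "\<lambda>t. - (1 / (t + c))"]
    by (auto simp: barrier_def)
  then have "a n * (- ln (s + c) - - ln (t + c) - - (1 / (t + c)) * (s - t))
      \<le> a' n * (- ln (s + c) - - ln (t + c) - - (1 / (t + c)) * (s - t))"
    using assms by (intro mult_right_mono)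
  then show "a n * - ln (s + c) - a n * - ln (t + c) - a n * - (1 / (t + c)) * (s - t)
      \<le> a' n * - ln (s + c) - a' n * - ln (t + c) - a' n * - (1 / (t + c)) * (s - t)"
    by (simp add: algebra_simps)
qed

text \<open>The derivative of \<open>phi r v\<close>. Both branches equal
  \<open>- (1 / (v + r))\<close> at \<open>t = v\<close>, so the quadratic continues the logarithm
  with a continuous derivative.\<close>

definition phi' :: "real \<Rightarrow> real \<Rightarrow> real \<Rightarrow> real" where
  "phi' r v t = (if v \<le> t then (t - v) / (v + r)\<^sup>2 - 1 / (v + r) else - (1 / (t + r)))"

lemma has_derivative_phi:
  assumes "- r < v" "- r < t"
  shows "(phi r v has_real_derivative phi' r v t) (at t)"
proof -
  define q where "q = (\<lambda>s. (s - v)\<^sup>2 / (2 * (v + r)\<^sup>2) - (s - v) / (v + r))"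
  define l where "l = (\<lambda>s. - ln ((s + r) / (v + r)))"
  have phi: "phi r v = (\<lambda>s. if s \<in> {v..} then q s else l s)"
    by (auto simp: phi_def q_def l_def fun_eq_iff)
  have q: "(q has_real_derivative (s - v) / (v + r)\<^sup>2 - 1 / (v + r)) (at s within S)" for s S
  proof -
    have "((\<lambda>s. (s - v)\<^sup>2 / (2 * (v + r)\<^sup>2)) has_real_derivative 2 * (s - v) / (2 * (v + r)\<^sup>2)) (at s within S)"
      by (rule DERIV_cdivide) (auto intro!: derivative_eq_intros)
    moreover have "2 * (s - v) / (2 * (v + r)\<^sup>2) = (s - v) / (v + r)\<^sup>2"
      by (rule mult_divide_mult_cancel_left) simp
    moreover have "((\<lambda>s. (s - v) / (v + r)) has_real_derivative 1 / (v + r)) (at s within S)"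
      by (rule DERIV_cdivide) (auto intro!: derivative_eq_intros)
    ultimately show ?thesis unfolding q_def by (simp only: DERIV_diff)
  qed
  have l: "(l has_real_derivative - (1 / (s + r))) (at s within S)" if "- r < s" for s S
  proof -
    have "((\<lambda>s. (s + r) / (v + r)) has_real_derivative 1 / (v + r)) (at s within S)"
      by (rule DERIV_cdivide) (auto intro!: derivative_eq_intros)
    from DERIV_minus[OF DERIV_ln_divide[THEN DERIV_chain2, OF _ this]] show ?thesis
      unfolding l_def using that assms by simp
  qed
  \<comment> \<open>The closures of the two pieces meet only at \<open>v\<close>, where values and
    derivatives of \<open>q\<close> and \<open>l\<close> agree; this is what gluing
    requires.\<close>
  have "((\<lambda>s. if s \<in> {v..} then q s else l s) has_vector_derivative
    (if t \<in> {v..} then (t - v) / (v + r)\<^sup>2 - 1 / (v + r) else - (1 / (t + r)))) (at t within {-r<..})"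
  proof (rule has_vector_derivative_If_within_closures[where T = "{-r<..<v}"])
    show "{-r<..} = {v..} \<union> {-r<..<v}" using assms by auto
  qed (use assms q l in \<open>auto simp: q_def l_def simp flip: has_real_derivative_iff_has_vector_derivative\<close>)
  then show ?thesis
    using assms by (simp add: phi phi'_def at_within_open[of t "{-r<..}"]
        flip: has_real_derivative_iff_has_vector_derivative)
qed

text \<open>Near \<open>-r\<close> only the logarithmic branch is active, so both limits are
  inherited from \<open>barrier_ln\<close>.\<close>

lemma barrier_phi:
  assumes "- r < v"
  shows "barrier r (phi r v) (phi' r v)"
proof -
  have low: "\<forall>\<^sub>F t in at_right (-r). t < v"
    using assms by (simp add: eventually_at_right_field) (auto intro: exI[of _ v])
  have "filterlim (\<lambda>t. ln (v + r) + - ln (t + r)) at_top (at_right (-r))"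
    by (rule filterlim_tendsto_add_at_top[OF tendsto_const])
      (use barrier_ln[of r] in \<open>simp add: barrier_def\<close>)
  moreover have "\<forall>\<^sub>F t in at_right (-r). ln (v + r) + - ln (t + r) = phi r v t"
    using low eventually_at_right_less[of "-r"]
    by eventually_elim (use assms in \<open>simp add: phi_def ln_div\<close>)
  ultimately have "filterlim (phi r v) at_top (at_right (-r))"
    using filterlim_mono_eventually by blast
  moreover have "filterlim (phi' r v) at_bot (at_right (-r))"
  proof (rule filterlim_mono_eventually[OF _ order_refl order_refl])
    show "filterlim (\<lambda>t. - (1 / (t + r))) at_bot (at_right (-r))"
      using barrier_ln[of r] by (simp add: barrier_def)
    show "\<forall>\<^sub>F t in at_right (-r). - (1 / (t + r)) = phi' r v t"
      using low by eventually_elim (simp add: phi'_def)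
  qed
  moreover have "strict_mono_on {-r<..} (phi' r v)"
  proof (rule strict_mono_onI)
    fix s t :: real
    assume st: "s \<in> {-r<..}" "t \<in> {-r<..}" "s < t"
    have up: "(s - v) / (v + r)\<^sup>2 < (t - v) / (v + r)\<^sup>2"
      using st assms by (intro divide_strict_right_mono) auto
    have low: "1 / (w + r) < 1 / (s + r)" if "s < w" for w
      using st that by (intro frac_less2) auto
    have nn: "0 \<le> (t - v) / (v + r)\<^sup>2" if "v \<le> t" using that by simp
    show "phi' r v s < phi' r v t"
    proof (cases "v \<le> s \<or> t < v")
      case True
      then show ?thesis using up low[of t] st by (auto simp: phi'_def)
    next
      case False
      \<comment> \<open>Here \<open>s < v \<le> t\<close>; the branches are compared through their
        common value at \<open>v\<close>.\<close>
      then have "- (1 / (s + r)) < - (1 / (v + r))" using low[of v] by simp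
      also have "\<dots> \<le> phi' r v t" using False nn by (simp only: phi'_def not_less de_Morgan_disj) simp
      finally show ?thesis using False by (simp add: phi'_def)
    qed
  qed
  ultimately show ?thesis using has_derivative_phi[OF assms] by (simp add: barrier_def)
qed

text \<open>The difference \<open>phi r v t + ln (t + r)\<close> is convex: it is constant for \<open>t < v\<close>, and its second
  derivative \<open>1 / (v + r)\<^sup>2 - 1 / (t + r)\<^sup>2\<close> is nonnegative for \<open>t \<ge> v\<close>.\<close>

lemma bregman_ln_le_phi:
  assumes "- r < v" "- r < s" "- r < t"
  shows "- ln (s + r) - - ln (t + r) - - (1 / (t + r)) * (s - t)
    \<le> phi r v s - phi r v t - phi' r v t * (s - t)"
proof -
  define g where "g = (\<lambda>t. phi r v t + ln (t + r))"
  define g' where "g' = (\<lambda>t. phi' r v t + 1 / (t + r))"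
  have g'_ge: "g' t = (t - v) / (v + r)\<^sup>2 - (1 / (v + r) - 1 / (t + r))" if "v \<le> t" for t
    using that by (simp add: g'_def phi'_def)
  have g'_lt: "g' t = 0" if "t < v" for t
    using that by (simp add: g'_def phi'_def)
  have mono_ge: "g' a \<le> g' b" if "v \<le> a" "a \<le> b" for a b
  proof -
    \<comment> \<open>A secant form of the second-derivative comparison: both factors of the
      denominator are at least \<open>v + r\<close>.\<close>
    have "1 / (a + r) - 1 / (b + r) = (b - a) / ((a + r) * (b + r))"
      using that assms by (simp add: field_simps)
    also have "\<dots> \<le> (b - a) / (v + r)\<^sup>2"
      unfolding power2_eq_square using that assms
      by (intro divide_left_mono mult_mono mult_pos_pos) auto
    also have "\<dots> = (b - v) / (v + r)\<^sup>2 - (a - v) / (v + r)\<^sup>2"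
      by (simp flip: diff_divide_distrib)
    finally show ?thesis using that by (simp add: g'_ge)
  qed
  have "mono_on {-r<..} g'"
  proof (rule mono_onI)
    fix a b :: real
    assume "a \<le> b"
    then show "g' a \<le> g' b"
      using mono_ge[of a b] mono_ge[of v b] g'_lt[of a] g'_lt[of b] g'_ge[of v]
      by (cases "v \<le> a"; cases "v \<le> b") auto
  qed
  moreover have "(g has_real_derivative g' t) (at t)" if "- r < t" for t
    unfolding g_def g'_def using that has_derivative_phi[OF assms(1) that]
    by (auto intro!: derivative_eq_intros)
  \<comment> \<open>Rearranged, the tangent inequality for the difference \<open>g\<close> is the
    comparison of the two Bregman distances.\<close>
  ultimately have "g t + g' t * (s - t) \<le> g s"
    using assms by (intro above_tangent[where c = "-r"]) auto
  then show ?thesis by (simp add: g_def g'_def algebra_simps)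
qed

section \<open>The Poisson likelihood\<close>

lemma shifted_orthant_mono: "shifted_orthant c \<subseteq> shifted_orthant d" if "c \<le> d"
proof
  fix x :: "real ^ 'n"
  assume "x \<in> shifted_orthant c"
  then have "- d < x $ n" for n using shifted_orthantD[of x c n] that by linarith
  then show "x \<in> shifted_orthant d" by (simp add: shifted_orthant_def)
qed

lemma rho_le: "rho H b \<le> zeta H m * b $ m"
  unfolding rho_def by (rule Min_le) auto

text \<open>Writes the intensity in variables shifted by \<open>c\<close>. The residual is
  nonnegative for \<open>c \<le> rho H b\<close> under the positivity assumptions below, and
  vanishes for \<open>c = zeta H m * b $ m\<close>.\<close>

lemma matrix_vector_plus_shift:
  fixes H :: "real ^ 'n ^ 'm"
  shows "(H *v x) $ m + b $ m =
    (\<Sum>n\<in>UNIV. H $ m $ n * (x $ n + c)) + (b $ m - c * (\<Sum>n\<in>UNIV. H $ m $ n))"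
  by (simp add: matrix_vector_mult_def algebra_simps sum.distrib sum_distrib_left)

lemma h4_eq: "h4 H y b \<mu> z = separable \<mu> (\<lambda>n t. a4 H y b \<mu> z n * - ln (t + \<mu>))"
  by (simp add: h4_def separable_def sum_negf)

lemma h1_eq: "h1 H y b z = separable (rho H b) (\<lambda>n t. a1 H y b z n * - ln (t + rho H b))"
  by (simp add: h1_def separable_def sum_negf)

lemma h2_eq: "h2 H y b = separable (rho H b) (\<lambda>n t. a2 H y n * - ln (t + rho H b))"
  by (simp add: h2_def separable_def sum_negf)

lemma h3_eq: "h3 H y b z = separable (rho H b) (\<lambda>n t. a1 H y b z n * phi (rho H b) (z $ n) t)"
  by (simp add: h3_def separable_def)

text \<open>Row \<open>m\<close> of (Maj-4), with \<open>x\<close>, \<open>z\<close> already shifted by \<open>\<mu>\<close>. The weights \<open>w n * z n / Z\<close>, completed by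
  the weight \<open>\<beta> / Z\<close> of the ratio \<open>1\<close>, exhibit \<open>X / Z\<close> as a convex combination of the ratios
  \<open>x n / z n\<close> and \<open>1\<close>; the bound is Jensen's inequality for \<open>-ln\<close>, obtained by summing
  \<open>ln u \<le> u - 1\<close> at \<open>u = ratio * Z / X\<close>.\<close>

lemma weighted_ln_jensen:
  fixes w x z :: "'n::finite \<Rightarrow> real"
  assumes w: "\<And>n. 0 \<le> w n" and x: "\<And>n. 0 < x n" and z: "\<And>n. 0 < z n" and \<beta>: "0 \<le> \<beta>"
    and X: "X = (\<Sum>n\<in>UNIV. w n * x n) + \<beta>" "0 < X"
    and Z: "Z = (\<Sum>n\<in>UNIV. w n * z n) + \<beta>" "0 < Z"
  shows "- ln X + ln Z + (X - Z) / Z \<le>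
    (\<Sum>n\<in>UNIV. w n * z n / Z * (- ln (x n) + ln (z n) + (x n - z n) / z n))"
proof -
  have "w n * z n * (ln (x n) - ln (z n) - ln X + ln Z) \<le> w n * x n * (Z / X) - w n * z n" for n
  proof -
    have "ln (x n / z n * (Z / X)) \<le> x n / z n * (Z / X) - 1"
      using x z X Z by (intro ln_le_minus_one) simp
    moreover have "ln (x n / z n * (Z / X)) = ln (x n) - ln (z n) - ln X + ln Z"
      using x[of n] z[of n] X Z by (simp add: ln_mult ln_div)
    ultimately have "w n * z n * (ln (x n) - ln (z n) - ln X + ln Z)
        \<le> w n * z n * (x n / z n * (Z / X) - 1)"
      using w[of n] z[of n] by (intro mult_left_mono) auto
    also have "\<dots> = w n * x n * (Z / X) - w n * z n"
      using z[of n] by (simp add: field_simps)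
    finally show ?thesis .
  qed
  then have "(\<Sum>n\<in>UNIV. w n * z n * (ln (x n) - ln (z n) - ln X + ln Z))
      \<le> (\<Sum>n\<in>UNIV. w n * x n * (Z / X) - w n * z n)"
    by (rule sum_mono)
  also have "\<dots> = (X - \<beta>) * (Z / X) - (Z - \<beta>)"
    by (simp only: X(1) Z(1) sum_subtractf sum_distrib_right[symmetric] add_diff_cancel_right')
  also have "\<dots> = - \<beta> * (Z / X - 1)"
    using X by (simp add: field_simps)
  \<comment> \<open>The contribution of the ratio \<open>1\<close>: the bound
    \<open>ln u \<le> u - 1\<close> at \<open>u = Z / X\<close>, reversed by the factor
    \<open>- \<beta>\<close>.\<close>
  also have "\<dots> \<le> - \<beta> * ln (Z / X)"
    using \<beta> ln_le_minus_one[of "Z / X"] X Z by (simp add: mult_left_mono)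
  finally have 1: "(\<Sum>n\<in>UNIV. w n * z n * (ln (x n) - ln (z n) - ln X + ln Z)) \<le> - \<beta> * (ln Z - ln X)"
    using X Z by (simp add: ln_div)
  have "(\<Sum>n\<in>UNIV. w n * z n * (ln (x n) - ln (z n) - ln X + ln Z))
    = (\<Sum>n\<in>UNIV. w n * z n * (ln (x n) - ln (z n))) + (\<Sum>n\<in>UNIV. w n * z n) * (ln Z - ln X)"
    unfolding sum_distrib_right sum.distrib[symmetric] by (intro sum.cong) (auto simp: algebra_simps)
  with 1 have 2: "(\<Sum>n\<in>UNIV. w n * z n * (ln (x n) - ln (z n))) \<le> Z * (ln X - ln Z)"
    unfolding Z(1) by (simp add: algebra_simps)
  have "Z * (- ln X + ln Z + (X - Z) / Z) = Z * (ln Z - ln X) + (X - Z)"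
    using Z(2) by (simp add: field_simps)
  also have "\<dots> \<le> (\<Sum>n\<in>UNIV. w n * z n * (ln (z n) - ln (x n))) + (X - Z)"
    using 2 by (simp add: algebra_simps sum_subtractf)
  \<comment> \<open>The constant \<open>\<beta>\<close> cancels in \<open>X - Z\<close>, so the
    linear term splits over the coordinates.\<close>
  also have "\<dots> = (\<Sum>n\<in>UNIV. w n * z n * (ln (z n) - ln (x n))) + (\<Sum>n\<in>UNIV. w n * (x n - z n))"
    unfolding X(1) Z(1) by (simp add: algebra_simps sum_subtractf)
  also have "\<dots> = (\<Sum>n\<in>UNIV. w n * z n * (- ln (x n) + ln (z n) + (x n - z n) / z n))"
    unfolding sum.distrib[symmetric]
  proof (intro sum.cong refl)
    fix n
    show "w n * z n * (ln (z n) - ln (x n)) + w n * (x n - z n)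
      = w n * z n * (- ln (x n) + ln (z n) + (x n - z n) / z n)"
      using z[of n] by (simp add: field_simps)
  qed
  also have "\<dots> = Z * (\<Sum>n\<in>UNIV. w n * z n / Z * (- ln (x n) + ln (z n) + (x n - z n) / z n))"
    unfolding sum_distrib_left using Z(2) by (intro sum.cong) auto
  finally show ?thesis using Z(2) by (rule mult_left_le_imp_le)
qed

section \<open>Positivity of the intensities, the coefficients, and the majorant (Maj-4)\<close>

context
  fixes H :: "real ^ 'n ^ 'm" and y :: "nat ^ 'm" and b :: "real ^ 'm"
  assumes H_nonneg: "\<And>m n. 0 \<le> H $ m $ n"
    and b_pos: "\<And>m. 0 < b $ m"
    and H_rows: "\<And>m. 0 < (\<Sum>n\<in>UNIV. H $ m $ n)"
    and Hty_pos: "\<And>n. 0 < (transpose H *v (\<chi> m. real (y $ m))) $ n"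
begin

lemma rho_nonneg: "0 \<le> rho H b"
proof -
  have "rho H b \<in> range (\<lambda>m. zeta H m * b $ m)"
    unfolding rho_def by (rule Min_in) auto
  then show ?thesis
    using b_pos H_rows by (auto simp: zeta_def less_imp_le)
qed

text \<open>The reason for taking \<open>rho\<close> as a minimum over the rows: the residual
  \<open>\<beta>\<close> of the Jensen bound is nonnegative in every row.\<close>

lemma shift_row_sum_le:
  assumes "\<mu> \<le> rho H b"
  shows "\<mu> * (\<Sum>n\<in>UNIV. H $ m $ n) \<le> b $ m"
proof -
  have "\<mu> \<le> b $ m / (\<Sum>n\<in>UNIV. H $ m $ n)"
    using assms rho_le[of H b m] by (simp add: zeta_def)
  then show ?thesis using H_rows[of m] by (simp add: pos_le_divide_eq)
qed

text \<open>A row with positive sum has a nonzero entry, whose shifted term is strictly positive;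
  the other terms and the residual are nonnegative.\<close>

lemma intensity_pos:
  assumes "\<mu> \<le> rho H b" "x \<in> shifted_orthant \<mu>"
  shows "0 < (H *v x) $ m + b $ m"
proof -
  note x = shifted_orthantD[OF assms(2)]
  obtain k where "H $ m $ k \<noteq> 0" using H_rows[of m] by (metis less_irrefl sum.neutral)
  then have "0 < H $ m $ k * (x $ k + \<mu>)" using x H_nonneg[of m k] by auto
  then have "0 < (\<Sum>n\<in>UNIV. H $ m $ n * (x $ n + \<mu>))"
    using x H_nonneg by (intro sum_pos2[of UNIV k]) (auto simp: less_imp_le)
  then show ?thesis
    using shift_row_sum_le[OF assms(1), of m] by (simp add: matrix_vector_plus_shift[where c = \<mu>])
qed

lemma ell_has_derivative:
  assumes "x \<in> shifted_orthant (rho H b)"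
  shows "(ell H y b has_derivative
    (\<lambda>v. - (\<Sum>m\<in>UNIV. real (y $ m) * ((H *v v) $ m / ((H *v x) $ m + b $ m))))) (at x)"
proof -
  have "((\<lambda>x. (H *v x) $ m + b $ m) has_derivative (\<lambda>v. (H *v v) $ m)) (at x)" for m
  proof -
    have "bounded_linear (\<lambda>v. (H *v v) $ m)"
      using bounded_linear_compose[OF bounded_linear_vec_nth matrix_vector_mul_bounded_linear] .
    from bounded_linear_imp_has_derivative[OF this] show ?thesis
      by (auto intro!: derivative_eq_intros)
  qed
  from has_derivative_ln[OF intensity_pos[OF order_refl assms] this]
  show ?thesis unfolding ell_def
    by (intro has_derivative_minus has_derivative_sum has_derivative_mult_right)
      (simp add: divide_inverse mult.commute)
qed

text \<open>Turns positivity of a component of the back-projected counts into a single row that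
  makes each coefficient strictly positive.\<close>

lemma exists_positive_count: "\<exists>m. 0 < y $ m \<and> 0 < H $ m $ n"
proof (rule ccontr)
  assume none: "\<nexists>m. 0 < y $ m \<and> 0 < H $ m $ n"
  have "H $ m $ n * real (y $ m) = 0" for m
  proof (cases "y $ m = 0")
    case False
    then have "\<not> 0 < H $ m $ n" using none by blast
    then show ?thesis using H_nonneg[of m n] by simp
  qed simp
  moreover have "0 < (\<Sum>m\<in>UNIV. H $ m $ n * real (y $ m))"
    using Hty_pos[of n] by (simp add: matrix_vector_mult_def transpose_def)
  ultimately show False by (simp only: sum.neutral_const less_irrefl)
qed

lemma a4_pos:
  assumes "\<mu> \<le> rho H b" "z \<in> shifted_orthant \<mu>"
  shows "0 < a4 H y b \<mu> z n"
proof -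
  note z = shifted_orthantD[OF assms(2), of n]
  obtain m where "0 < y $ m" "0 < H $ m $ n" using exists_positive_count[of n] by blast
  then have "0 < real (y $ m) * (H $ m $ n * (z $ n + \<mu>) / ((H *v z) $ m + b $ m))"
    using z intensity_pos[OF assms] by simp
  moreover have "0 \<le> real (y $ k) * (H $ k $ n * (z $ n + \<mu>) / ((H *v z) $ k + b $ k))" for k
    using z intensity_pos[OF assms, of k] H_nonneg[of k n] by simp
  ultimately show ?thesis
    unfolding a4_def by (intro sum_pos2[of UNIV m]) auto
qed

lemma a4_le_a1:
  assumes "z \<in> shifted_orthant (rho H b)"
  shows "a4 H y b (rho H b) z n \<le> a1 H y b z n"
  unfolding a4_def a1_def
proof (rule sum_mono)
  fix m
  have "H $ m $ n * (z $ n + rho H b) \<le> H $ m $ n * (z $ n + zeta H m * b $ m)"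
    using rho_le[of H b m] H_nonneg[of m n] by (simp add: mult_left_mono)
  then have "H $ m $ n * (z $ n + rho H b) / ((H *v z) $ m + b $ m)
      \<le> H $ m $ n * (z $ n + zeta H m * b $ m) / ((H *v z) $ m + b $ m)"
    using intensity_pos[OF order_refl assms, of m] by (simp only: divide_right_mono less_imp_le)
  then show "real (y $ m) * (H $ m $ n * (z $ n + rho H b) / ((H *v z) $ m + b $ m))
      \<le> real (y $ m) * (H $ m $ n * (z $ n + zeta H m * b $ m) / ((H *v z) $ m + b $ m))"
    by (rule mult_left_mono) simp
qed

text \<open>Since \<open>zeta\<close> normalises the row, the intensity is the sum of the terms
  \<open>H $ m $ k * (z $ k + zeta H m * b $ m)\<close>. Each quotient is thus one nonnegative term
  over the total: at most \<open>1\<close>, and \<open>0\<close> where the entry vanishes.\<close>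

lemma a1_le_a2:
  assumes "z \<in> shifted_orthant (rho H b)"
  shows "a1 H y b z n \<le> a2 H y n"
  unfolding a1_def a2_def
proof (intro sum_mono mult_left_mono)
  fix m
  have nonneg: "0 \<le> H $ m $ k * (z $ k + zeta H m * b $ m)" for k
    using shifted_orthantD[OF assms, of k] rho_le[of H b m] H_nonneg[of m k]
    by (intro mult_nonneg_nonneg) auto
  have "H $ m $ n * (z $ n + zeta H m * b $ m) \<le> (\<Sum>k\<in>UNIV. H $ m $ k * (z $ k + zeta H m * b $ m))"
    using nonneg by (intro member_le_sum) auto
  also have "\<dots> = (H *v z) $ m + b $ m"
    using H_rows[of m] by (simp add: matrix_vector_plus_shift[where c = "zeta H m * b $ m"] zeta_def)
  finally show "H $ m $ n * (z $ n + zeta H m * b $ m) / ((H *v z) $ m + b $ m)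
      \<le> of_bool (H $ m $ n \<noteq> 0)"
    using intensity_pos[OF order_refl assms, of m] by (cases "H $ m $ n = 0") auto
qed auto

text \<open>The rowwise Jensen bounds, weighted by the counts and summed, become the Bregman
  distance of \<open>h4\<close> once the two sums are exchanged.\<close>

lemma majorant_h4:
  assumes \<mu>: "0 \<le> \<mu>" "\<mu> \<le> rho H b" and z: "z \<in> shifted_orthant \<mu>"
  shows "bregman_tangent_majorant (ell H y b) (shifted_orthant \<mu>) z (h4 H y b \<mu> z)"
proof -
  note bar = barrier_scale[OF barrier_ln a4_pos[OF \<mu>(2) z]]
  have sub: "x \<in> shifted_orthant (rho H b)" if "x \<in> shifted_orthant \<mu>" for x :: "real ^ 'n"
    using that shifted_orthant_mono[OF \<mu>(2)] by blast
  have "ell H y b x \<le> tangent_approx (ell H y b) (h4 H y b \<mu> z) x z"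
    if x: "x \<in> shifted_orthant \<mu>" for x
  proof -
    define X where "X m = (H *v x) $ m + b $ m" for m
    define Z where "Z m = (H *v z) $ m + b $ m" for m
    \<comment> \<open>The Bregman distance of the one-dimensional barrier
      \<open>- ln (t + \<mu>)\<close> from \<open>z $ n\<close> to \<open>x $ n\<close>.\<close>
    define d where "d n = - ln (x $ n + \<mu>) + ln (z $ n + \<mu>) + (x $ n - z $ n) / (z $ n + \<mu>)" for n
    have XZ: "X m - Z m = (H *v (x - z)) $ m" for m
      by (simp add: X_def Z_def matrix_vector_mult_diff_distrib)
    have "- ln (X m) + ln (Z m) + (X m - Z m) / Z m
        \<le> (\<Sum>n\<in>UNIV. H $ m $ n * (z $ n + \<mu>) / Z m *
            (- ln (x $ n + \<mu>) + ln (z $ n + \<mu>) + (x $ n + \<mu> - (z $ n + \<mu>)) / (z $ n + \<mu>)))" for m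
    proof (rule weighted_ln_jensen)
      show "0 \<le> b $ m - \<mu> * (\<Sum>n\<in>UNIV. H $ m $ n)" using shift_row_sum_le[OF \<mu>(2), of m] by simp
      show "X m = (\<Sum>n\<in>UNIV. H $ m $ n * (x $ n + \<mu>)) + (b $ m - \<mu> * (\<Sum>n\<in>UNIV. H $ m $ n))"
        "Z m = (\<Sum>n\<in>UNIV. H $ m $ n * (z $ n + \<mu>)) + (b $ m - \<mu> * (\<Sum>n\<in>UNIV. H $ m $ n))"
        unfolding X_def Z_def by (rule matrix_vector_plus_shift)+
      show "0 < X m" "0 < Z m"
        unfolding X_def Z_def using intensity_pos[OF \<mu>(2)] x z by blast+
    qed (use shifted_orthantD[OF x] shifted_orthantD[OF z] H_nonneg in blast)+
    then have "(\<Sum>m\<in>UNIV. real (y $ m) * (- ln (X m) + ln (Z m) + (X m - Z m) / Z m))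
        \<le> (\<Sum>m\<in>UNIV. real (y $ m) * (\<Sum>n\<in>UNIV. H $ m $ n * (z $ n + \<mu>) / Z m * d n))"
      unfolding d_def by (intro sum_mono mult_left_mono) auto
    also have "\<dots> = (\<Sum>n\<in>UNIV. \<Sum>m\<in>UNIV. real (y $ m) * (H $ m $ n * (z $ n + \<mu>) / Z m * d n))"
      unfolding sum_distrib_left by (rule sum.swap)
    also have "\<dots> = (\<Sum>n\<in>UNIV. a4 H y b \<mu> z n * d n)"
      unfolding a4_def Z_def sum_distrib_right by (simp add: mult.assoc)
    also have "\<dots> = bregman_dist (h4 H y b \<mu> z) x z"
      unfolding h4_eq bregman_dist_separable[OF bar x z] d_def
      by (intro sum.cong) (auto simp: algebra_simps)
    finally have "(\<Sum>m\<in>UNIV. real (y $ m) * (- ln (X m) + ln (Z m) + (X m - Z m) / Z m))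
      \<le> bregman_dist (h4 H y b \<mu> z) x z" .
    moreover have "ell H y b x = - (\<Sum>m\<in>UNIV. real (y $ m) * ln (X m))"
      "ell H y b z = - (\<Sum>m\<in>UNIV. real (y $ m) * ln (Z m))"
      by (simp_all add: ell_def X_def Z_def)
    moreover have "grad (ell H y b) z \<bullet> (x - z) = - (\<Sum>m\<in>UNIV. real (y $ m) * ((X m - Z m) / Z m))"
      unfolding inner_grad[OF ell_has_derivative[OF sub[OF z]]] XZ by (simp add: Z_def)
    \<comment> \<open>The weighted left-hand side is \<open>ell\<close> at \<open>x\<close> minus
      its linearisation at \<open>z\<close>.\<close>
    moreover have "(\<Sum>m\<in>UNIV. real (y $ m) * (- ln (X m) + ln (Z m) + (X m - Z m) / Z m))
      = - (\<Sum>m\<in>UNIV. real (y $ m) * ln (X m)) + (\<Sum>m\<in>UNIV. real (y $ m) * ln (Z m))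
      + (\<Sum>m\<in>UNIV. real (y $ m) * ((X m - Z m) / Z m))"
      unfolding distrib_left sum.distrib mult_minus_right sum_negf ..
    ultimately show ?thesis unfolding tangent_approx_def by linarith
  qed
  moreover have "ell H y b differentiable_on shifted_orthant \<mu>"
    using ell_has_derivative[OF sub] has_derivative_at_withinI
    unfolding differentiable_on_def differentiable_def by blast
  moreover have "legendre (h4 H y b \<mu> z)"
    unfolding h4_eq by (rule legendre_separable[OF bar])
  ultimately show ?thesis
    using z by (simp add: bregman_tangent_majorant_def open_shifted_orthant h4_eq)
qed

section \<open>Comparisons and the remaining majorants at a fixed tangency point\<close>

context
  fixes z :: "real ^ 'n" assumes z: "z \<in> shifted_orthant (rho H b)"
begin

text \<open>Strict positivity propagates upwards along the coefficient chain from \<open>a4\<close>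
  at \<open>rho H b\<close>.\<close>

lemma a1_pos: "0 < a1 H y b z n"
  using a4_pos[OF order_refl z] a4_le_a1[OF z] by (rule less_le_trans)

lemma a2_pos: "0 < a2 H y n"
  using a1_pos a1_le_a2[OF z] by (rule less_le_trans)

lemma barrier_h3:
  "barrier (rho H b) (\<lambda>t. a1 H y b z n * phi (rho H b) (z $ n) t)
    (\<lambda>t. a1 H y b z n * phi' (rho H b) (z $ n) t)"
proof (rule barrier_scale[OF barrier_phi a1_pos])
  show "- rho H b < z $ n" using z by (simp add: shifted_orthant_def)
qed

lemma legendre_h1: "legendre (h1 H y b z)"
  unfolding h1_eq by (rule legendre_separable[OF barrier_scale[OF barrier_ln a1_pos]])

lemma legendre_h2: "legendre (h2 H y b)"
  unfolding h2_eq by (rule legendre_separable[OF barrier_scale[OF barrier_ln a2_pos]])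

lemma legendre_h3: "legendre (h3 H y b z)"
  unfolding h3_eq by (rule legendre_separable[OF barrier_h3])

lemma h4_le_h1: "h4 H y b (rho H b) z \<preceq>\<^sub>L h1 H y b z"
  unfolding h4_eq h1_eq using a4_pos[OF order_refl z] a4_le_a1[OF z] by (rule legendre_le_ln_scale)

lemma h1_le_h2: "h1 H y b z \<preceq>\<^sub>L h2 H y b"
  unfolding h1_eq h2_eq using a1_pos a1_le_a2[OF z] by (rule legendre_le_ln_scale)

text \<open>Both functions carry the same coefficients \<open>a1\<close>, so the claim reduces to
  \<open>bregman_ln_le_phi\<close> in each coordinate.\<close>

lemma h1_le_h3: "h1 H y b z \<preceq>\<^sub>L h3 H y b z"
  unfolding h1_eq h3_eq
proof (rule legendre_le_separable)
  show "barrier (rho H b) (\<lambda>t. a1 H y b z n * - ln (t + rho H b))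
      (\<lambda>t. a1 H y b z n * - (1 / (t + rho H b)))" for n
    using barrier_ln a1_pos by (rule barrier_scale)
  show "barrier (rho H b) (\<lambda>t. a1 H y b z n * phi (rho H b) (z $ n) t)
      (\<lambda>t. a1 H y b z n * phi' (rho H b) (z $ n) t)" for n
    by (rule barrier_h3)
  fix n and s t :: real
  assume "- rho H b < s" "- rho H b < t"
  then have "a1 H y b z n * (- ln (s + rho H b) - - ln (t + rho H b) - - (1 / (t + rho H b)) * (s - t))
    \<le> a1 H y b z n * (phi (rho H b) (z $ n) s - phi (rho H b) (z $ n) t - phi' (rho H b) (z $ n) t * (s - t))"
    using z less_imp_le[OF a1_pos]
    by (intro mult_left_mono bregman_ln_le_phi) (auto simp: shifted_orthant_def)
  then show "a1 H y b z n * - ln (s + rho H b) - a1 H y b z n * - ln (t + rho H b)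
      - a1 H y b z n * - (1 / (t + rho H b)) * (s - t)
    \<le> a1 H y b z n * phi (rho H b) (z $ n) s - a1 H y b z n * phi (rho H b) (z $ n) t
      - a1 H y b z n * phi' (rho H b) (z $ n) t * (s - t)"
    by (simp only: right_diff_distrib mult.assoc)
qed

lemma majorant_h1: "bregman_tangent_majorant (ell H y b) (shifted_orthant (rho H b)) z (h1 H y b z)"
  using majorant_h4[OF rho_nonneg order_refl z] h4_le_h1 legendre_h1
  by (rule bregman_tangent_majorant_mono) (simp add: h4_eq h1_eq)

lemma majorant_h2: "bregman_tangent_majorant (ell H y b) (shifted_orthant (rho H b)) z (h2 H y b)"
  using majorant_h1 h1_le_h2 legendre_h2
  by (rule bregman_tangent_majorant_mono) (simp add: h1_eq h2_eq)

lemma majorant_h3: "bregman_tangent_majorant (ell H y b) (shifted_orthant (rho H b)) z (h3 H y b z)"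
  using majorant_h1 h1_le_h3 legendre_h3
  by (rule bregman_tangent_majorant_mono) (simp add: h1_eq h3_eq)

end

end

theorem proposition5p2:
  fixes H :: "real ^ 'n ^ 'm" and y :: "nat ^ 'm" and b :: "real ^ 'm"
  assumes H_nonneg: "\<And>m n. 0 \<le> H $ m $ n"
    and b_pos: "\<And>m. 0 < b $ m"
    and H_rows: "\<And>m. 0 < (\<Sum>n\<in>UNIV. H $ m $ n)"
    and Hty_pos: "\<And>n. 0 < (transpose H *v (\<chi> m. real (y $ m))) $ n"
  shows
    "(\<forall>z \<in> shifted_orthant (rho H b).
        legendre (h1 H y b z) \<and>
        bregman_tangent_majorant (ell H y b) (shifted_orthant (rho H b)) z (h1 H y b z)) \<and>
     (\<forall>z \<in> shifted_orthant (rho H b).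
        legendre (h2 H y b) \<and>
        bregman_tangent_majorant (ell H y b) (shifted_orthant (rho H b)) z (h2 H y b)) \<and>
     (\<forall>z \<in> shifted_orthant (rho H b).
        legendre (h3 H y b z) \<and>
        bregman_tangent_majorant (ell H y b) (shifted_orthant (rho H b)) z (h3 H y b z)) \<and>
     (\<forall>\<mu> \<in> {0..rho H b}. \<forall>z \<in> shifted_orthant \<mu>.
        legendre (h4 H y b \<mu> z) \<and>
        bregman_tangent_majorant (ell H y b) (shifted_orthant \<mu>) z (h4 H y b \<mu> z)) \<and>
     (\<forall>z \<in> shifted_orthant (rho H b).
        h1 H y b z \<preceq>\<^sub>L h2 H y b \<and>
        h1 H y b z \<preceq>\<^sub>L h3 H y b z \<and>
        (\<forall>\<mu>. \<mu> = rho H b \<longrightarrow> h4 H y b \<mu> z \<preceq>\<^sub>L h1 H y b z))"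
proof -
  note ctx = H_nonneg b_pos H_rows Hty_pos
  have 4: "legendre (h4 H y b \<mu> z) \<and>
      bregman_tangent_majorant (ell H y b) (shifted_orthant \<mu>) z (h4 H y b \<mu> z)"
    if "\<mu> \<in> {0..rho H b}" "z \<in> shifted_orthant \<mu>" for \<mu> z
    using majorant_h4[OF ctx, of \<mu> z] that by (simp add: bregman_tangent_majorant_def)
  show ?thesis
    by (intro conjI ballI allI impI)
      (simp_all only: legendre_h1[OF ctx] majorant_h1[OF ctx] legendre_h2[OF ctx] majorant_h2[OF ctx]
        legendre_h3[OF ctx] majorant_h3[OF ctx] h1_le_h2[OF ctx] h1_le_h3[OF ctx] h4_le_h1[OF ctx] 4)
qed

end
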